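(* Let $G$ be a topological group with neutral element $e$, let $\sigma: G\to G$ be an involutive automorphism, and let $z_0\in Z(G)$, the center of $G$, be given. Consider the functional equation $$f(y^{-1}xz_0)-f(x\sigma(y)z_0)=2f(x)f(y)\quad\text{for all }x,y\in G \qquad ( * )$$ for continuous functions $f: G\to\mathbb{C}$. (1) If $\sigma(z_0)z_0=e$, then $( * )$ has no non-zero continuous solutions. (2) If $\sigma(z_0)z_0\neq e$, then every non-zero continuous solution $f$ of $( * )$ has one of the following forms: (a) $f(x)=\dfrac{\chi(x)-\chi(x^{-1})}{2\chi(z_0)}$ for all $x\in G$, where $\chi: G\to\mathbb{C}^{*}$ is a continuous multiplicative function such that $\chi(\sigma(x))=\chi(x)$ for all $x\in G$ and $\chi(z_0)^2=-1$; (b) $f(x)=\dfrac{\chi(x)-\chi(\sigma(x))}{2\chi(z_0)}$ for all $x\in G$, where $\chi: G\to\mathbb{C}^{*}$ is a continuous multiplicative function such that $\chi(x)=\chi(x^{-1})$ for all $x\in G$ and $\chi(\sigma(z_0)z_0)=-1$.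
   Context: $\sigma$ being an involutive automorphism means $\sigma(xy)=\sigma(x)\sigma(y)$ and $\sigma(\sigma(x))=x$ for all $x,y\in G$. A function $\chi$ is multiplicative if $\chi(xy)=\chi(x)\chi(y)$ for all $x,y\in G$. $\mathbb{C}^*=\mathbb{C}\setminus\{0\}$. Non-zero means not identically zero. *)

theory Defs
  imports Complex_Main
begin

text \<open>
  Topological groups are rendered by the library class \<open>topological_group_add\<close>. Its underlying
  class \<open>group_add\<close> does not assume commutativity and its topology is not assumed to be Hausdorff;
  only the notation is additive: \<open>x + y\<close>, \<open>- x\<close> and \<open>0\<close> stand for
  \<open>xy\<close>, \<open>x\<^sup>-\<^sup>1\<close> and \<open>e\<close>.
\<close>

definition group_center :: "'a::group_add set" where
  "group_center = {z. \<forall>x. z + x = x + z}"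

text \<open>
  No continuity is required. Bijectivity need not be demanded, since a map that is its own
  inverse is bijective.
\<close>

definition involutive_automorphism :: "('a::group_add \<Rightarrow> 'a) \<Rightarrow> bool" where
  "involutive_automorphism \<sigma> \<longleftrightarrow>
    (\<forall>x y. \<sigma> (x + y) = \<sigma> x + \<sigma> y) \<and> (\<forall>x. \<sigma> (\<sigma> x) = x)"

text \<open>
  Multiplicative functions \<open>chi : G \<rightarrow> \<complex>\<close>; the group operation on the left is written additively.
\<close>

definition multiplicative :: "('a::group_add \<Rightarrow> complex) \<Rightarrow> bool" where
  "multiplicative chi \<longleftrightarrow> (\<forall>x y. chi (x + y) = chi x * chi y)"

text \<open>\<open>f(y\<^sup>-\<^sup>1xz\<^sub>0) - f(x\<sigma>(y)z\<^sub>0) = 2f(x)f(y)\<close>\<close>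

definition solves_equation :: "('a::group_add \<Rightarrow> 'a) \<Rightarrow> 'a \<Rightarrow> ('a \<Rightarrow> complex) \<Rightarrow> bool" where
  "solves_equation \<sigma> z0 f \<longleftrightarrow>
    (\<forall>x y. f (- y + x + z0) - f (x + \<sigma> y + z0) = 2 * f x * f y)"

end

theory Submission
  imports Defs
begin

text \<open>
  Write the group additively, let \<open>f\<close> be a non-zero solution, and put \<open>g x = f (x + z)\<close> with
  \<open>z = z0\<close>. The equation then reads \<open>g (- y + x) - g (x + \<sigma> y) = 2 f x f y\<close>, and \<open>f\<close> and \<open>g\<close>
  play the parts of sine and cosine.

  Setting \<open>x = 0\<close> shows that \<open>g\<close> is invariant under the anti-automorphism \<open>x \<mapsto> - \<sigma> x\<close>; feeding
  this back into the equation shows that \<open>f\<close> changes sign under it (\<open>f_minus_sigma\<close>). Since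
  \<open>g\<close> is a translate of \<open>f\<close>, the two symmetries together yield
  \<open>f (x + (\<sigma> z + z)) = - f x\<close> (\<open>f_add_period\<close>), which excludes \<open>\<sigma> z + z = 0\<close>.

  The case \<open>y = z\<close> of the equation then gives \<open>f z = 1\<close>, and the case \<open>x = z\<close> makes \<open>g\<close> even
  (\<open>g_minus\<close>).

  Because \<open>\<sigma> z + z\<close> is an antiperiod, translating both variables by \<open>z\<close> turns the sine equation
  into the cosine equation
  \<open>g (- y + x) + g (x + \<sigma> y) = 2 g x g y\<close>. Half the sum and half the difference of the two
  equations are two addition formulas; comparing them shows that \<open>g (x + y) = g (y + x)\<close> and,
  since \<open>f z = 1\<close>, that \<open>f (- x) = \<epsilon> f x\<close> with the constant \<open>\<epsilon> = f (- z)\<close> satisfying \<open>\<epsilon>\<^sup>2 = 1\<close>. So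
  no noncommutative phenomenon survives, and the formulas become
  \<open>g (x + y) = g x g y + \<epsilon> f x f y\<close> and \<open>f (x + y) = g x f y + f x g y\<close>. Hence
  \<open>\<chi> = g + \<delta> f\<close> is multiplicative whenever \<open>\<delta>\<^sup>2 = \<epsilon>\<close>, and \<open>\<chi> z = \<delta>\<close>. The case
  \<open>\<epsilon> = - 1\<close>, where \<open>f\<close> is odd and \<open>\<sigma>\<close>-invariant, gives form (a); the case \<open>\<epsilon> = 1\<close>, where \<open>f\<close>
  is even and \<open>\<sigma>\<close> reverses its sign, gives form (b).
\<close>

lemma half_sum: "(a::complex) = r * s + p * q"
  and half_difference: "b = r * s - p * q"
  if "a - b = 2 * p * q" "a + b = 2 * r * s"
proof -
  have "2 * a = 2 * (r * s + p * q)" "2 * b = 2 * (r * s - p * q)"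
    using that by (auto simp: algebra_simps)
  then show "a = r * s + p * q" "b = r * s - p * q"
    unfolding mult_cancel_left by simp_all
qed

section \<open>Symmetries of a solution\<close>

locale nonzero_solution =
  fixes \<sigma> :: "'a::group_add \<Rightarrow> 'a" and z :: 'a and f :: "'a \<Rightarrow> complex"
  assumes automorphism: "involutive_automorphism \<sigma>"
    and center: "z \<in> group_center"
    and nonzero: "\<exists>x. f x \<noteq> 0"
    and equation: "solves_equation \<sigma> z f"
begin

definition g :: "'a \<Rightarrow> complex" where
  "g x = f (x + z)"

lemma sigma_add: "\<sigma> (x + y) = \<sigma> x + \<sigma> y"
  and sigma_sigma [simp]: "\<sigma> (\<sigma> x) = x"
  using automorphism by (simp_all add: involutive_automorphism_def)

lemma sigma_zero [simp]: "\<sigma> 0 = 0"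
  by (metis add.right_neutral add_left_cancel sigma_add)

lemma sigma_minus: "\<sigma> (- x) = - \<sigma> x"
proof -
  have "\<sigma> (- x) + \<sigma> x = 0"
    by (simp flip: sigma_add)
  then show ?thesis
    by (simp add: eq_neg_iff_add_eq_0)
qed

lemma z_commute: "z + x = x + z"
  using center by (simp add: group_center_def)

lemma sigma_z_commute: "\<sigma> z + x = x + \<sigma> z"
  using z_commute [of "\<sigma> x"] sigma_add by (metis sigma_sigma)

lemma conj_z [simp]: "- z + x + z = x"
  by (metis add.assoc minus_add_cancel z_commute)

lemma sine_equation: "g (- y + x) - g (x + \<sigma> y) = 2 * f x * f y"
  using equation by (simp add: solves_equation_def g_def)

lemma f_zero [simp]: "f 0 = 0"
proof -
  obtain x where "f x \<noteq> 0"
    using nonzero by blast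
  with sine_equation [of 0 x] show ?thesis
    by simp
qed

lemma g_sigma_eq_g_minus: "g (\<sigma> x) = g (- x)"
  using sine_equation [of x 0] by simp

text \<open>
  Replacing \<open>x\<close> by \<open>- \<sigma> x\<close> interchanges the two terms on the left of the sine equation,
  because \<open>g\<close> is invariant under the anti-automorphism \<open>w \<mapsto> - \<sigma> w\<close>.
\<close>

lemma f_minus_sigma: "f (- \<sigma> x) = - f x"
proof -
  obtain y where y: "f y \<noteq> 0"
    using nonzero by blast
  have "g (- y + - \<sigma> x) = g (x + \<sigma> y)"
    using g_sigma_eq_g_minus [of "\<sigma> x + y"] by (simp add: sigma_add minus_add)
  moreover have "g (- \<sigma> x + \<sigma> y) = g (- y + x)"
    using g_sigma_eq_g_minus [of "- x + y"] by (simp add: sigma_add sigma_minus minus_add)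
  ultimately have "g (- y + - \<sigma> x) - g (- \<sigma> x + \<sigma> y) = - (g (- y + x) - g (x + \<sigma> y))"
    by (simp only: minus_diff_eq)
  then have "2 * f (- \<sigma> x) * f y = 2 * (- f x) * f y"
    by (simp only: sine_equation mult_minus_left mult_minus_right)
  with y show ?thesis
    unfolding mult_cancel_right mult_cancel_left by simp
qed

lemma f_sigma: "f (\<sigma> x) = - f (- x)"
  using f_minus_sigma [of "- x"] by (simp add: sigma_minus)

text \<open>
  Invariance of the translate \<open>g\<close> under \<open>w \<mapsto> - \<sigma> w\<close> is invariance of \<open>f\<close> under the conjugate of
  this reflection by the translation by \<open>z\<close>. The reflection and its conjugate compose to the
  translation by \<open>\<sigma> z + z\<close>, and exactly one of them reverses the sign of \<open>f\<close>.
\<close>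

lemma f_add_period: "f (x + (\<sigma> z + z)) = - f x"
proof -
  have "f (x + (\<sigma> z + z)) = g (\<sigma> (\<sigma> x + z))"
    by (simp add: g_def sigma_add add.assoc)
  also have "\<dots> = f (- z + - \<sigma> x + z)"
    unfolding g_sigma_eq_g_minus by (simp only: g_def minus_add)
  also have "\<dots> = - f x"
    by (simp only: conj_z f_minus_sigma)
  finally show ?thesis .
qed

lemma sigma_z_add_z_nonzero: "\<sigma> z + z \<noteq> 0"
proof
  assume "\<sigma> z + z = 0"
  then have "f x = 0" for x
    using f_add_period [of x] by simp
  with nonzero show False
    by blast
qed

lemma f_z [simp]: "f z = 1"
proof -
  obtain x where x: "f x \<noteq> 0"
    using nonzero by blast
  have "f x - f (x + (\<sigma> z + z)) = 2 * f x * f z"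
    using sine_equation [of z x] unfolding g_def conj_z by (simp add: add.assoc)
  with x show ?thesis
    by (simp add: f_add_period)
qed

text \<open>
  With \<open>x = z\<close> the two terms of the equation are negatives of each other: the symmetries of \<open>f\<close>
  carry one argument to the other up to twice the antiperiod \<open>\<sigma> z + z\<close>. As \<open>f z = 1\<close>, the
  equation collapses to \<open>f (- y + z + z) = f y\<close>, which is evenness of \<open>g\<close>.
\<close>

lemma g_minus: "g (- x) = g x"
proof -
  define y where "y = x + z"
  let ?w = "- \<sigma> z + - y + - \<sigma> z"
  have "z + \<sigma> y + z = \<sigma> (\<sigma> z + y + \<sigma> z)"
    by (simp add: sigma_add)
  then have "f (z + \<sigma> y + z) = - f ?w"
    by (simp only: f_sigma minus_add add.assoc)
  moreover have "f ?w = f (?w + (\<sigma> z + z) + (\<sigma> z + z))"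
    by (simp only: f_add_period minus_minus)
  moreover have "?w + (\<sigma> z + z) + (\<sigma> z + z) = - y + z + z"
  proof -
    have "?w + (\<sigma> z + z) + (\<sigma> z + z) = - \<sigma> z + (- y + z + \<sigma> z) + z"
      by (simp only: add.assoc minus_add_cancel)
    also have "- y + z + \<sigma> z = \<sigma> z + (- y + z)"
      by (rule sigma_z_commute [symmetric])
    finally show ?thesis
      by (simp add: add.assoc)
  qed
  moreover have "f (- y + z + z) - f (z + \<sigma> y + z) = 2 * f y"
    using sine_equation [of y z] by (simp add: g_def)
  ultimately have "f (- y + z + z) = f y"
    by simp
  moreover have "- y + z = - x"
    by (simp only: y_def minus_add conj_z)
  ultimately show ?thesis
    by (simp add: g_def y_def)
qed

lemma g_sigma: "g (\<sigma> x) = g x"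
  by (simp add: g_sigma_eq_g_minus g_minus)

section \<open>Addition formulas\<close>

text \<open>
  Adding \<open>z\<close> to both variables of the sine equation moves its second term by the antiperiod
  \<open>\<sigma> z + z\<close>, which turns the difference into a sum.
\<close>

lemma cosine_equation: "g (- y + x) + g (x + \<sigma> y) = 2 * g x * g y"
proof -
  have 1: "- (y + z) + (x + z) = - y + x"
  proof -
    have "- (y + z) + (x + z) = - z + (- y + x) + z"
      by (simp only: minus_add add.assoc)
    then show ?thesis
      by (simp only: conj_z)
  qed
  have 2: "x + z + \<sigma> (y + z) + z = x + \<sigma> y + z + (\<sigma> z + z)"
  proof -
    have "x + z + \<sigma> (y + z) + z = x + (z + (\<sigma> y + \<sigma> z)) + z"
      by (simp only: sigma_add add.assoc)
    also have "z + (\<sigma> y + \<sigma> z) = \<sigma> y + (z + \<sigma> z)"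
      by (simp only: z_commute [of "\<sigma> y + \<sigma> z"] z_commute [of "\<sigma> z"] add.assoc)
    finally show ?thesis
      by (simp only: add.assoc)
  qed
  have "g (x + z + \<sigma> (y + z)) = - g (x + \<sigma> y)"
    by (simp only: g_def 2 f_add_period)
  with sine_equation [of "y + z" "x + z"] show ?thesis
    by (simp add: 1 g_def)
qed

text \<open>
  Half the difference of the sine and cosine equations gives the first formula, with \<open>\<sigma> y\<close> for \<open>y\<close>;
  half their sum gives the second, with \<open>- y\<close> for \<open>y\<close>.
\<close>

lemma g_add: "g (x + y) = g x * g y + f x * f (- y)"
  using half_difference [OF sine_equation cosine_equation, of x "\<sigma> y"]
  by (simp add: f_sigma g_sigma)

lemma g_add_swapped: "g (y + x) = g x * g y + f x * f (- y)"
  using half_sum [OF sine_equation cosine_equation, of "- y" x]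
  by (simp add: g_minus)

text \<open>
  The two formulas agree up to exchanging \<open>x\<close> and \<open>y\<close> on the left, so \<open>f x * f (- y)\<close> is
  symmetric in \<open>x\<close> and \<open>y\<close>; now put \<open>y = z\<close>.
\<close>

lemma f_minus: "f (- x) = f (- z) * f x"
  using g_add [of z x] g_add_swapped [of z x] by (simp add: mult.commute)

lemma f_minus_z_square: "f (- z) * f (- z) = 1"
  using f_minus [of "- z"] by (simp only: minus_minus f_z)

text \<open>
  As sine and cosine differ by a quarter period, the addition formula of \<open>f\<close> is that of \<open>g\<close> with
  the second argument translated by \<open>- z\<close>.
\<close>

lemma f_add: "f (x + y) = g x * f y + f x * g y"
proof -
  have f_eq_g: "f w = g (w + - z)" for w
    by (simp add: g_def add.assoc)
  have "- (y + - z) = - y + z"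
    using z_commute [of "- y"] by (simp add: minus_add)
  then have "f (- (y + - z)) = g y"
    by (simp add: g_minus flip: g_def)
  then have "g (x + (y + - z)) = g x * f y + f x * g y"
    using g_add [of x "y + - z"] by (simp only: f_eq_g [symmetric])
  then show ?thesis
    by (simp only: f_eq_g [of "x + y"] add.assoc)
qed

lemma g_zero: "g 0 = 1"
  by (simp add: g_def)

lemma g_z: "g z = 0"
  using g_minus [of z] by (simp add: g_def)

section \<open>The character of a solution\<close>

definition character :: "complex \<Rightarrow> 'a \<Rightarrow> complex" where
  "character \<delta> x = g x + \<delta> * f x"

lemma character_z: "character \<delta> z = \<delta>"
  by (simp add: character_def g_z)

lemma character_minus: "character \<delta> (- x) = g x + f (- z) * (\<delta> * f x)"
  by (simp add: character_def g_minus f_minus [of x])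

lemma character_sigma: "character \<delta> (\<sigma> x) = g x - f (- z) * (\<delta> * f x)"
  by (simp add: character_def g_sigma f_sigma f_minus [of x])

text \<open>
  Expanding \<open>(g x + \<delta> f x) (g y + \<delta> f y)\<close> yields \<open>g (x + y)\<close> from the terms of even degree in
  \<open>\<delta>\<close>, since \<open>\<delta>\<^sup>2\<close> is the factor by which \<open>x \<mapsto> - x\<close> multiplies \<open>f\<close>, and \<open>\<delta> f (x + y)\<close>
  from the terms of odd degree.
\<close>

lemma multiplicative_character:
  assumes "\<delta>\<^sup>2 = f (- z)"
  shows "multiplicative (character \<delta>)"
proof -
  have "f (- y) = \<delta> * \<delta> * f y" for y
    using assms f_minus [of y] by (simp add: power2_eq_square)
  then show ?thesis
    by (simp add: multiplicative_def character_def g_add f_add algebra_simps)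
qed

lemma character_nonzero:
  assumes "\<delta>\<^sup>2 = f (- z)"
  shows "character \<delta> x \<noteq> 0"
proof
  assume "character \<delta> x = 0"
  then have "character \<delta> (x + - x) = 0"
    using multiplicative_character [OF assms] unfolding multiplicative_def by (metis mult_zero_left)
  then show False
    by (simp add: character_def g_zero)
qed

lemma character_period: "character \<delta> (\<sigma> z + z) = - 1"
proof -
  have "f (\<sigma> z + z) = 0"
    using f_add_period [of 0] by simp
  moreover have "g (\<sigma> z + z) = - 1"
    using f_add_period [of z] z_commute [of "\<sigma> z + z"] by (simp add: g_def)
  ultimately show ?thesis
    by (simp add: character_def)
qed

end

lemma continuous_on_character:
  fixes \<sigma> :: "'a::topological_group_add \<Rightarrow> 'a"
  assumes "nonzero_solution \<sigma> z f" and "continuous_on UNIV f"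
  shows "continuous_on UNIV (nonzero_solution.character z f \<delta>)"
proof -
  interpret nonzero_solution \<sigma> z f
    by fact
  have "continuous_on UNIV (\<lambda>x. f (x + z))"
    by (rule continuous_on_compose2 [OF assms(2)]) (auto intro!: continuous_intros)
  with assms(2) show ?thesis
    unfolding character_def g_def by (intro continuous_intros)
qed

theorem theorem4p3:
  fixes \<sigma> :: "'a::topological_group_add \<Rightarrow> 'a" and z0 :: 'a
  assumes "involutive_automorphism \<sigma>"
    and "z0 \<in> group_center"
  shows "(\<sigma> z0 + z0 = 0 \<longrightarrow>
           \<not> (\<exists>f :: 'a \<Rightarrow> complex.
                continuous_on UNIV f \<and> (\<exists>x. f x \<noteq> 0) \<and> solves_equation \<sigma> z0 f))
       \<and> (\<sigma> z0 + z0 \<noteq> 0 \<longrightarrow>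
           (\<forall>f :: 'a \<Rightarrow> complex.
              continuous_on UNIV f \<and> (\<exists>x. f x \<noteq> 0) \<and> solves_equation \<sigma> z0 f \<longrightarrow>
              (\<exists>chi :: 'a \<Rightarrow> complex.
                 continuous_on UNIV chi \<and> multiplicative chi \<and> (\<forall>x. chi x \<noteq> 0)
                 \<and> (\<forall>x. chi (\<sigma> x) = chi x) \<and> (chi z0)\<^sup>2 = -1
                 \<and> (\<forall>x. f x = (chi x - chi (- x)) / (2 * chi z0)))
            \<or> (\<exists>chi :: 'a \<Rightarrow> complex.
                 continuous_on UNIV chi \<and> multiplicative chi \<and> (\<forall>x. chi x \<noteq> 0)
                 \<and> (\<forall>x. chi x = chi (- x)) \<and> chi (\<sigma> z0 + z0) = -1
                 \<and> (\<forall>x. f x = (chi x - chi (\<sigma> x)) / (2 * chi z0)))))"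
proof (intro conjI impI allI notI)
  assume "\<sigma> z0 + z0 = 0"
    and "\<exists>f :: 'a \<Rightarrow> complex. continuous_on UNIV f \<and> (\<exists>x. f x \<noteq> 0) \<and> solves_equation \<sigma> z0 f"
  then show False
    using assms nonzero_solution.sigma_z_add_z_nonzero nonzero_solution.intro by blast
next
  fix f :: "'a \<Rightarrow> complex"
  assume f: "continuous_on UNIV f \<and> (\<exists>x. f x \<noteq> 0) \<and> solves_equation \<sigma> z0 f"
  interpret nonzero_solution \<sigma> z0 f
    using assms f by unfold_locales auto
  have continuous: "continuous_on UNIV (character \<delta>)" for \<delta>
    using f nonzero_solution_axioms by (blast intro: continuous_on_character)
  have "f (- z0) = - 1 \<or> f (- z0) = 1"
    using f_minus_z_square by (simp add: square_eq_1_iff disj_commute)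
  then show "(\<exists>chi :: 'a \<Rightarrow> complex.
                 continuous_on UNIV chi \<and> multiplicative chi \<and> (\<forall>x. chi x \<noteq> 0)
                 \<and> (\<forall>x. chi (\<sigma> x) = chi x) \<and> (chi z0)\<^sup>2 = -1
                 \<and> (\<forall>x. f x = (chi x - chi (- x)) / (2 * chi z0)))
            \<or> (\<exists>chi :: 'a \<Rightarrow> complex.
                 continuous_on UNIV chi \<and> multiplicative chi \<and> (\<forall>x. chi x \<noteq> 0)
                 \<and> (\<forall>x. chi x = chi (- x)) \<and> chi (\<sigma> z0 + z0) = -1
                 \<and> (\<forall>x. f x = (chi x - chi (\<sigma> x)) / (2 * chi z0)))"
  proof
    assume odd: "f (- z0) = - 1"
    then have root: "\<i>\<^sup>2 = f (- z0)"
      by simp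
    show ?thesis
      by (intro disjI1 exI [of _ "character \<i>"] conjI allI continuous
            multiplicative_character [OF root] character_nonzero [OF root])
        (simp_all add: odd character_z character_minus character_sigma, simp_all add: character_def)
  next
    assume even: "f (- z0) = 1"
    then have root: "1\<^sup>2 = f (- z0)"
      by simp
    show ?thesis
      by (intro disjI2 exI [of _ "character 1"] conjI allI continuous
            multiplicative_character [OF root] character_nonzero [OF root] character_period)
        (simp_all add: even character_z character_minus character_sigma, simp_all add: character_def)
  qed
qed

end
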